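(* Let $\gamma$ be a non-zero algebraic number with $\deg\gamma\le 2$. (i) If $\mathbb Q(\gamma)\neq\mathbb Q(i)$ and $\mathbb Q(\gamma)\ne\mathbb Q(i\sqrt3)$, then $\bar M(\gamma)=M(\gamma)$. (ii) If $\gamma=a+bi$ with $a,b\in\mathbb Q$, then $\bar M(\gamma)=M(b)$ if $a=0$, and $\bar M(\gamma)=M(\gamma)$ if $a\neq0$. (iii) If $\gamma=a+b\sqrt{-3}$ with $a,b\in\mathbb Q$, then $\bar M(\gamma)=M(2a)$ if $a\in\{b,-b\}$, and $\bar M(\gamma)=M(\gamma)$ if $a\notin\{b,-b\}$.
   Context: For a non-zero algebraic number $\gamma$ with minimal polynomial $A\prod_{n=1}^N(x-\gamma_n)$ over $\mathbb Z$ (primitive, $A>0$), $M(\gamma)=A\prod_{n=1}^N\max\{1,|\gamma_n|\}$. The modified Mahler measure is $\bar M(\gamma)=\inf\{M(\zeta\gamma):\zeta\text{ a root of unity}\}$. *)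

theory Defs
  imports "HOL-Computational_Algebra.Polynomial" "Berlekamp_Zassenhaus.Mahler_Measure"
begin

definition is_min_int_poly :: "complex \<Rightarrow> int poly \<Rightarrow> bool" where
  "is_min_int_poly x p \<longleftrightarrow>
     p \<noteq> 0 \<and> poly (map_poly of_int p) x = 0 \<and> content p = 1 \<and> lead_coeff p > 0 \<and>
     (\<forall>q. q \<noteq> 0 \<and> poly (map_poly of_int q) x = (0::complex) \<longrightarrow> degree p \<le> degree q)"

definition min_int_poly :: "complex \<Rightarrow> int poly" where
  "min_int_poly x = (THE p. is_min_int_poly x p)"

definition alg_degree :: "complex \<Rightarrow> nat" where
  "alg_degree x = degree (min_int_poly x)"

definition M :: "complex \<Rightarrow> real" where
  "M x = mahler_measure (min_int_poly x)"

definition root_of_unity :: "complex \<Rightarrow> bool" where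
  "root_of_unity z \<longleftrightarrow> (\<exists>n::nat. n > 0 \<and> z ^ n = 1)"

definition Mbar :: "complex \<Rightarrow> real" where
  "Mbar x = (INF z \<in> {z. root_of_unity z}. M (z * x))"

definition is_subfield_C :: "complex set \<Rightarrow> bool" where
  "is_subfield_C F \<longleftrightarrow> 0 \<in> F \<and> 1 \<in> F \<and>
     (\<forall>x\<in>F. \<forall>y\<in>F. x + y \<in> F \<and> x * y \<in> F) \<and> (\<forall>x\<in>F. - x \<in> F) \<and>
     (\<forall>x\<in>F. x \<noteq> 0 \<longrightarrow> inverse x \<in> F)"

definition Qadj :: "complex \<Rightarrow> complex set" where
  "Qadj x = \<Inter> {F. is_subfield_C F \<and> x \<in> F}"

end

theory Submission
  imports Defs "Jordan_Normal_Form.Determinant"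
begin

text \<open>
  If \<open>\<alpha>\<^sup>n = \<beta>\<^sup>n\<close> then \<open>M \<alpha>\<close> and \<open>M \<beta>\<close> agree after normalising by the degree. Indeed, for a primitive
  integer polynomial \<open>p\<close> with leading coefficient \<open>A\<close> and roots \<open>\<alpha>\<^sub>j\<close>, the polynomial
  \<open>\<plusminus> A\<^sup>n \<Prod>(t - \<alpha>\<^sub>j\<^sup>n)\<close> is the norm of \<open>p(y)\<close> from \<open>\<int>[y]\<close> down to \<open>\<int>[t]\<close>, where \<open>t = y\<^sup>n\<close>. It is therefore
  integral, it is primitive (reduce modulo a prime and look at the leading coefficient that survives),
  and its Mahler measure is that of \<open>p\<close> to the power \<open>n\<close>. When \<open>p\<close> is the minimal polynomial of
  \<open>\<alpha>\<close>, this norm is up to sign a power of the minimal polynomial of \<open>\<alpha>\<^sup>n\<close>.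

  Hence the infimum defining \<open>Mbar \<gamma>\<close> is attained at any \<open>\<zeta>\<gamma>\<close> of least degree. For \<open>\<gamma>\<close> of degree two
  this differs from \<open>M \<gamma>\<close> only if \<open>\<gamma> = r z\<close> with \<open>r\<close> rational and \<open>z\<close> a quadratic root of unity; then
  \<open>2 Re z\<close> is an integer of absolute value less than two, so \<open>z\<close> is \<open>\<plusminus>\<i>\<close> or a primitive third or sixth root
  of unity.
\<close>

subsection \<open>The norm of a polynomial in \<open>y\<close> down to polynomials in \<open>y\<^sup>n\<close>\<close>

text \<open>
  Multiplication by \<open>y\<close> and by \<open>p(y)\<close> on the free \<open>R[t]\<close>-module \<open>R[y]\<close>, where \<open>t = y\<^sup>n\<close>, in the basis
  \<open>1, y, \<dots>, y\<^bsup>n-1\<^esup>\<close>.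
\<close>

definition root_shift_mat :: "nat \<Rightarrow> 'a :: comm_ring_1 poly mat" where
  "root_shift_mat n = mat n n (\<lambda>(i, j). if i = Suc j then 1 else if i = 0 \<and> j = n - 1 then [:0, 1:] else 0)"

definition power_mult_mat :: "nat \<Rightarrow> 'a :: comm_ring_1 poly \<Rightarrow> 'a poly mat" where
  "power_mult_mat n p = fold_coeffs (\<lambda>a A. [:a:] \<cdot>\<^sub>m 1\<^sub>m n + root_shift_mat n * A) p (0\<^sub>m n n)"

definition power_norm :: "nat \<Rightarrow> 'a :: comm_ring_1 poly \<Rightarrow> 'a poly" where
  "power_norm n p = det (power_mult_mat n p)"

lemma root_shift_mat_carrier [simp]: "root_shift_mat n \<in> carrier_mat n n"
  by (simp add: root_shift_mat_def)

lemma dim_root_shift_mat [simp]: "dim_row (root_shift_mat n) = n" "dim_col (root_shift_mat n) = n"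
  by (simp_all add: root_shift_mat_def)

lemma power_mult_mat_0 [simp]: "power_mult_mat n 0 = 0\<^sub>m n n"
  by (simp add: power_mult_mat_def)

lemma power_mult_mat_pCons:
  "power_mult_mat n (pCons a p) = [:a:] \<cdot>\<^sub>m 1\<^sub>m n + root_shift_mat n * power_mult_mat n p"
proof (cases "a = 0 \<and> p = 0")
  \<comment> \<open>\<open>fold_coeffs\<close> stops at the zero polynomial, and
    \<open>pCons 0 0\<close> is zero; so here the recursion holds only because the shift matrix
    times the zero matrix vanishes.\<close>
  case True
  have "root_shift_mat n * 0\<^sub>m n n = (0\<^sub>m n n :: 'a poly mat)"
    by (rule right_mult_zero_mat[OF root_shift_mat_carrier])
  thus ?thesis using True by (auto intro!: eq_matI)
qed (auto simp: power_mult_mat_def)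

lemma power_mult_mat_carrier [simp]: "power_mult_mat n p \<in> carrier_mat n n"
  by (induction p) (auto simp: power_mult_mat_pCons intro!: mult_carrier_mat)

lemma dim_power_mult_mat [simp]:
  "dim_row (power_mult_mat n p) = n" "dim_col (power_mult_mat n p) = n"
  by (simp_all only: carrier_matD[OF power_mult_mat_carrier])

lemma power_mult_mat_add:
  "power_mult_mat n (p + q) = power_mult_mat n p + power_mult_mat n q"
proof (induction p q rule: poly_induct2)
  case (pCons a p b q)
  let ?C = "root_shift_mat n :: 'a poly mat"
  let ?P = "power_mult_mat n p" and ?Q = "power_mult_mat n q"
  have "?C * (?P + ?Q) = ?C * ?P + ?C * ?Q"
    by (rule mult_add_distrib_mat[of _ n n _ n]) auto
  thus ?case using pCons
    by (auto simp: power_mult_mat_pCons intro!: eq_matI)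
qed auto

lemma power_mult_mat_smult:
  "power_mult_mat n (smult c p) = [:c:] \<cdot>\<^sub>m power_mult_mat n p"
proof (induction p)
  case (pCons a p)
  let ?C = "root_shift_mat n :: 'a poly mat"
  let ?P = "power_mult_mat n p"
  have "?C * ([:c:] \<cdot>\<^sub>m ?P) = [:c:] \<cdot>\<^sub>m (?C * ?P)"
    by (rule mult_smult_distrib[of _ n n _ n]) auto
  thus ?case using pCons
    by (auto simp: power_mult_mat_pCons algebra_simps intro!: eq_matI)
qed (auto intro!: eq_matI)

text \<open>Multiplication by \<open>y\<close> is the shift \<open>pCons 0\<close>, so this follows
  from linearity. Multiplicativity for linear factors suffices because the norm is evaluated on
  polynomials that split over the complex numbers.\<close>

lemma power_mult_mat_linear_factor:
  "power_mult_mat n ([:- b, 1:] * p) = (root_shift_mat n + [:- b:] \<cdot>\<^sub>m 1\<^sub>m n) * power_mult_mat n p"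
proof -
  let ?C = "root_shift_mat n :: 'a poly mat"
  let ?P = "power_mult_mat n p"
  have "[:- b, 1:] * p = pCons 0 p + smult (- b) p" by simp
  hence "power_mult_mat n ([:- b, 1:] * p) =
      [:0:] \<cdot>\<^sub>m 1\<^sub>m n + ?C * ?P + [:- b:] \<cdot>\<^sub>m ?P"
    by (simp only: power_mult_mat_add power_mult_mat_smult power_mult_mat_pCons)
  also have "[:0:] \<cdot>\<^sub>m 1\<^sub>m n + ?C * ?P = ?C * ?P"
    by (intro eq_matI) auto
  also have "[:- b:] \<cdot>\<^sub>m ?P = ([:- b:] \<cdot>\<^sub>m 1\<^sub>m n) * ?P"
    by (subst mult_smult_assoc_mat[of _ n n _ n]) auto
  also have "?C * ?P + \<dots> = (?C + [:- b:] \<cdot>\<^sub>m 1\<^sub>m n) * ?P"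
    by (rule add_mult_distrib_mat[of _ n n _ _ n, symmetric]) auto
  finally show ?thesis .
qed

text \<open>This is the norm of \<open>y - b\<close>. The first row is nonzero only in its first and
  last columns, and both minors are triangular: one is lower triangular with diagonal
  \<open>- b\<close>, the other upper triangular with diagonal \<open>1\<close>.\<close>

lemma det_root_shift_mat:
  assumes "n > 0"
  shows "det (root_shift_mat n + [:- b:] \<cdot>\<^sub>m 1\<^sub>m n) =
    smult ((-1) ^ (n - 1)) [:- (b ^ n), 1:]"
proof (cases "n = 1")
  case True
  thus ?thesis
    by (subst det_single) (auto simp: root_shift_mat_def)
next
  case False
  with assms obtain m where n: "n = Suc (Suc m)"
    by (metis One_nat_def gr0_implies_Suc neq0_conv)
  define A where "A = root_shift_mat n + [:- b:] \<cdot>\<^sub>m 1\<^sub>m n"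
  have A: "A \<in> carrier_mat n n" unfolding A_def by auto
  have ent: "A $$ (i, j) = (if i = j then [:- b:] else if i = Suc j then 1
      else if i = 0 \<and> j = n - 1 then [:0, 1:] else 0)" if "i < n" "j < n" for i j
    using that n unfolding A_def root_shift_mat_def by auto
  have "det A = (\<Sum>j<n. A $$ (0, j) * cofactor A 0 j)"
    using laplace_expansion_row[OF A, of 0] assms by simp
  also have "\<dots> = (\<Sum>j\<in>{0, n - 1}. A $$ (0, j) * cofactor A 0 j)"
    by (rule sum.mono_neutral_right) (use n ent in auto)
  also have "\<dots> = [:- b:] * det (mat_delete A 0 0)
      + [:0, 1:] * ((-1) ^ (n - 1) * det (mat_delete A 0 (n - 1)))"
    using n ent by (simp add: cofactor_def)
  also have "det (mat_delete A 0 0) = prod_list (diag_mat (mat_delete A 0 0))"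
    by (rule det_lower_triangular[of "n - 1"]) (use A n ent in \<open>auto simp: mat_delete_def\<close>)
  also have "diag_mat (mat_delete A 0 0) = map (\<lambda>_. [:- b:]) [0..<n - 1]"
    unfolding diag_mat_def by (use A n ent in \<open>auto simp: mat_delete_def\<close>)
  also have "prod_list \<dots> = [:- b:] ^ (n - 1)"
    by (simp add: map_replicate_const prod_list_replicate)
  also have "det (mat_delete A 0 (n - 1)) = prod_list (diag_mat (mat_delete A 0 (n - 1)))"
    by (rule det_upper_triangular[of _ "n - 1"]) (use A n ent in \<open>auto simp: mat_delete_def\<close>)
  also have "diag_mat (mat_delete A 0 (n - 1)) = map (\<lambda>_. 1) [0..<n - 1]"
    unfolding diag_mat_def by (use A n ent in \<open>auto simp: mat_delete_def\<close>)
  also have "prod_list \<dots> = (1 :: 'a poly)"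
    by (simp add: map_replicate_const prod_list_replicate)
  finally have "det A = [:- b:] ^ n + [:0, 1:] * (-1) ^ (n - 1)"
    using n by simp
  also have "(-1 :: 'a poly) ^ (n - 1) = [:(-1) ^ (n - 1):]"
    by (metis one_pCons poly_const_pow minus_pCons minus_zero)
  also have "[:- b:] ^ n = [:(- b) ^ n:]"
    by (simp add: poly_const_pow)
  also have "(- b) ^ n = (-1) ^ n * b ^ n"
    by (rule power_minus)
  finally show ?thesis using n unfolding A_def by simp
qed

lemma power_norm_const: "power_norm n [:c:] = [:c ^ n:]"
proof -
  have "root_shift_mat n * 0\<^sub>m n n = (0\<^sub>m n n :: 'a poly mat)"
    by (rule right_mult_zero_mat[OF root_shift_mat_carrier])
  hence "power_mult_mat n [:c:] = [:c:] \<cdot>\<^sub>m 1\<^sub>m n"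
    by (auto simp: power_mult_mat_pCons intro!: eq_matI)
  thus ?thesis by (simp add: power_norm_def poly_const_pow)
qed

lemma power_norm_linear_factor:
  assumes "n > 0"
  shows "power_norm n ([:- b, 1:] * p) = smult ((-1) ^ (n - 1)) [:- (b ^ n), 1:] * power_norm n p"
proof -
  have "power_norm n ([:- b, 1:] * p)
      = det (root_shift_mat n + [:- b:] \<cdot>\<^sub>m 1\<^sub>m n) * det (power_mult_mat n p)"
    unfolding power_norm_def power_mult_mat_linear_factor by (rule det_mult[of _ n]) auto
  thus ?thesis using assms by (simp only: det_root_shift_mat power_norm_def)
qed

text \<open>Each linear factor contributes a sign \<open>(-1) ^ (n - 1)\<close>. These are collected
  in \<open>s\<close>, which neither content, divisibility nor Mahler measure can see.\<close>

lemma power_norm_prod_linear_factors: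
  assumes "n > 0"
  shows "\<exists>s \<in> {1, - 1}. power_norm n (smult c (\<Prod>a\<leftarrow>as. [:- a, 1:])) =
    smult (s * c ^ n) (\<Prod>a\<leftarrow>as. [:- (a ^ n), 1:])"
proof (induction as)
  case Nil
  show ?case by (auto simp: power_norm_const)
next
  case (Cons a as)
  then obtain s where s: "s \<in> {1, - 1}" and
    eq: "power_norm n (smult c (\<Prod>a\<leftarrow>as. [:- a, 1:])) = smult (s * c ^ n) (\<Prod>a\<leftarrow>as. [:- (a ^ n), 1:])"
    by (rule bexE)
  have "smult c (\<Prod>a\<leftarrow>a # as. [:- a, 1:]) = [:- a, 1:] * smult c (\<Prod>a\<leftarrow>as. [:- a, 1:])"
    by (simp only: mult_smult_right list.map prod_list.Cons)
  hence "power_norm n (smult c (\<Prod>a\<leftarrow>a # as. [:- a, 1:])) =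
      power_norm n ([:- a, 1:] * smult c (\<Prod>a\<leftarrow>as. [:- a, 1:]))"
    by (rule arg_cong)
  also have "\<dots> = smult ((-1) ^ (n - 1)) [:- (a ^ n), 1:] *
      smult (s * c ^ n) (\<Prod>a\<leftarrow>as. [:- (a ^ n), 1:])"
    by (subst power_norm_linear_factor[OF assms], subst eq) (rule refl)
  also have "\<dots> = smult ((-1) ^ (n - 1) * s * c ^ n) (\<Prod>a\<leftarrow>a # as. [:- (a ^ n), 1:])"
    by (simp only: mult_smult_left mult_smult_right smult_smult list.map prod_list.Cons mult_ac)
  finally have "power_norm n (smult c (\<Prod>a\<leftarrow>a # as. [:- a, 1:])) =
    smult ((-1) ^ (n - 1) * s * c ^ n) (\<Prod>a\<leftarrow>a # as. [:- (a ^ n), 1:])" .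
  moreover have "(-1) ^ (n - 1) * s \<in> {1, - 1}"
    using s by (cases "even (n - 1)") auto
  ultimately show ?case by (rule bexI)
qed

text \<open>Determinants commute with ring homomorphisms. Thus the norm computed over the integers,
  integral by construction, can be factored over the complex numbers.\<close>

lemma power_norm_of_int:
  "map_poly of_int (power_norm n p) = power_norm n (map_poly of_int p :: 'a :: {comm_ring_1, ring_char_0} poly)"
proof -
  let ?h = "map_poly (of_int :: int \<Rightarrow> 'a)"
  have C: "map_mat ?h (root_shift_mat n) = root_shift_mat n"
    by (intro eq_matI) (auto simp: root_shift_mat_def hom_distribs)
  have "map_mat ?h (power_mult_mat n p) = power_mult_mat n (?h p)"
  proof (induction p)
    case 0
    show ?case by (intro eq_matI) auto
  next
    case (pCons a p)
    have "map_mat ?h (root_shift_mat n * power_mult_mat n p) =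
        map_mat ?h (root_shift_mat n) * map_mat ?h (power_mult_mat n p)"
      by (rule semiring_hom.mat_hom_mult[OF of_int_poly_hom.semiring_hom_axioms root_shift_mat_carrier
          power_mult_mat_carrier])
    moreover have "root_shift_mat n * power_mult_mat n p \<in> carrier_mat n n"
      by (rule mult_carrier_mat[of _ n n _ n]) auto
    moreover have "map_mat ?h ([:a:] \<cdot>\<^sub>m 1\<^sub>m n + X) = [:of_int a:] \<cdot>\<^sub>m 1\<^sub>m n + map_mat ?h X"
      if "X \<in> carrier_mat n n" for X
      using that by (intro eq_matI) (auto simp: hom_distribs)
    ultimately show ?case using pCons C
      by (simp add: power_mult_mat_pCons map_poly_pCons)
  qed
  thus ?thesis
    unfolding power_norm_def
    by (metis comm_ring_hom.hom_det of_int_poly_hom.comm_ring_hom_axioms)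
qed

text \<open>The factors are replaced one at a time. By the Leibniz formula the next lemma carries
  the congruence over to determinants.\<close>

lemma dvd_prod_diff:
  fixes f g :: "'b \<Rightarrow> 'a :: comm_ring_1"
  assumes "\<And>i. i \<in> I \<Longrightarrow> d dvd f i - g i"
  shows "d dvd prod f I - prod g I"
  using assms
proof (induction I rule: infinite_finite_induct)
  case (insert i I)
  have "prod f (insert i I) - prod g (insert i I) =
      f i * (prod f I - prod g I) + (f i - g i) * prod g I"
    using insert.hyps by (simp add: algebra_simps)
  thus ?case using insert by (auto intro!: dvd_add)
qed auto

lemma dvd_det_diff:
  fixes A B :: "'a :: comm_ring_1 mat"
  assumes "A \<in> carrier_mat n n" "B \<in> carrier_mat n n"
    and "\<And>i j. i < n \<Longrightarrow> j < n \<Longrightarrow> d dvd A $$ (i, j) - B $$ (i, j)"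
  shows "d dvd det A - det B"
  unfolding det_def'[OF assms(1)] det_def'[OF assms(2)] sum_subtractf[symmetric]
    right_diff_distrib[symmetric]
  by (intro dvd_sum dvd_mult dvd_prod_diff assms(3)) (auto simp: permutes_in_image)

text \<open>By linearity, adding \<open>smult d q\<close> changes every matrix entry by a multiple
  of \<open>[:d:]\<close>, and determinants respect congruences.\<close>

lemma power_norm_cong:
  "[:d:] dvd power_norm n (p + smult d q) - power_norm n p"
  unfolding power_norm_def
proof (rule dvd_det_diff[of _ n])
  fix i j assume "i < n" "j < n"
  thus "[:d:] dvd power_mult_mat n (p + smult d q) $$ (i, j) - power_mult_mat n p $$ (i, j)"
    by (auto simp: power_mult_mat_add power_mult_mat_smult intro!: dvdI[of _ _ "power_mult_mat n q $$ (i, j)"])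
qed auto

subsection \<open>Minimal polynomials over the integers\<close>

text \<open>The pseudo-remainder vanishes at \<open>x\<close> and has too small a degree, hence is
  zero. The scaling factor \<open>a\<close> of the pseudo-division is a unit over the fraction
  field, and Gauss's lemma for the primitive \<open>p\<close> returns to integer
  coefficients.\<close>

lemma is_min_int_poly_dvd:
  assumes p: "is_min_int_poly x p" and q: "poly (of_int_poly q) x = 0"
  shows "p dvd q"
proof -
  let ?r = "pseudo_mod q p"
  from p have p0: "p \<noteq> 0" by (simp add: is_min_int_poly_def)
  from pseudo_mod(1)[OF p0, of q] obtain a s where a: "a \<noteq> 0" "smult a q = p * s + ?r" by blast
  have "poly (of_int_poly (smult a q)) x = poly (of_int_poly (p * s + ?r)) x" using a(2) by simp
  hence "poly (of_int_poly ?r) x = 0"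
    using p q by (simp add: hom_distribs is_min_int_poly_def)
  hence "?r = 0"
    using p pseudo_mod(2)[OF p0, of q] unfolding is_min_int_poly_def by (meson not_le)
  hence "p dvd smult a q" using a(2) by simp
  hence "fract_poly p dvd smult (to_fract a) (fract_poly q)"
    by (metis fract_poly_dvd fract_poly_smult)
  hence "fract_poly p dvd fract_poly q"
    using a(1) by (simp add: dvd_smult_iff)
  moreover have "content p = 1" using p by (simp add: is_min_int_poly_def)
  ultimately show ?thesis by (rule fract_poly_dvdD)
qed

lemma is_min_int_poly_unique:
  assumes "is_min_int_poly x p" "is_min_int_poly x q"
  shows "p = q"
proof -
  have "p dvd q" "q dvd p"
    using assms is_min_int_poly_dvd unfolding is_min_int_poly_def by auto
  moreover from this have "lead_coeff p dvd lead_coeff q" "lead_coeff q dvd lead_coeff p"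
    by (metis dvdE dvd_triv_left lead_coeff_mult)+
  hence "lead_coeff p = lead_coeff q"
    using assms zdvd_antisym_nonneg unfolding is_min_int_poly_def by (meson less_imp_le)
  ultimately show ?thesis by (intro poly_dvd_antisym)
qed

lemma is_min_int_poly_exists:
  assumes "algebraic x"
  shows "\<exists>p. is_min_int_poly x p"
proof -
  let ?P = "\<lambda>p. p \<noteq> 0 \<and> poly (of_int_poly p) x = 0"
  from assms obtain p0 where "?P p0" by (rule algebraicE') auto
  then obtain p where p: "?P p" and min: "\<And>q. ?P q \<Longrightarrow> degree p \<le> degree q"
    using ex_has_least_nat[of ?P p0 degree] by blast
  \<comment> \<open>Passing to the primitive part normalises the content; the factor
    \<open>s\<close> makes the leading coefficient positive. Neither changes the degree or the root
    \<open>x\<close>.\<close>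
  define s where "s = sgn (lead_coeff p)"
  define q where "q = smult s (primitive_part p)"
  have s: "s \<in> {1, -1}" using p by (auto simp: s_def sgn_if)
  have pp: "p = smult (content p) (primitive_part p)" by simp
  have cp: "content p > 0"
    using p by (metis content_eq_zero_iff normalize_content normalize_int_def abs_ge_zero order_le_less)
  have "poly (of_int_poly (smult (content p) (primitive_part p))) x =
      of_int (content p) * poly (of_int_poly (primitive_part p)) x"
    by (simp only: hom_distribs poly_smult)
  hence "poly (of_int_poly p) x = of_int (content p) * poly (of_int_poly (primitive_part p)) x"
    by (simp only: content_times_primitive_part)
  hence "poly (of_int_poly q) x = 0" using p cp by (simp add: q_def hom_distribs)
  moreover have "q \<noteq> 0" using p s by (auto simp: q_def)
  moreover have "content q = 1" using p s by (auto simp: q_def)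
  moreover have "degree q = degree p" using s by (auto simp: q_def)
  moreover have "lead_coeff q > 0"
  proof -
    have "lead_coeff p = content p * lead_coeff (primitive_part p)"
      by (metis pp lead_coeff_smult)
    hence "content p * lead_coeff q = s * lead_coeff p" using s by (auto simp: q_def)
    also have "\<dots> = \<bar>lead_coeff p\<bar>" by (simp add: s_def abs_sgn mult.commute)
    also have "\<dots> > 0" using p by simp
    finally show ?thesis using cp by (simp add: zero_less_mult_iff)
  qed
  ultimately have "is_min_int_poly x q" using min by (simp add: is_min_int_poly_def)
  thus ?thesis by blast
qed

lemma min_int_poly_is_min:
  assumes "algebraic x"
  shows "is_min_int_poly x (min_int_poly x)"
proof -
  obtain p where p: "is_min_int_poly x p" using is_min_int_poly_exists[OF assms] by (rule exE)
  show ?thesis unfolding min_int_poly_def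
    by (rule theI[of _ p]) (rule p, rule is_min_int_poly_unique[OF _ p])
qed

lemma min_int_poly:
  assumes "algebraic x"
  shows "min_int_poly x \<noteq> 0" "poly (of_int_poly (min_int_poly x)) x = 0"
    "content (min_int_poly x) = 1" "lead_coeff (min_int_poly x) > 0"
  using min_int_poly_is_min[OF assms] by (auto simp: is_min_int_poly_def)

lemma algebraicI_int_poly:
  fixes x :: complex
  assumes "p \<noteq> 0" "poly (of_int_poly p) x = 0"
  shows "algebraic x"
  using assms by (intro algebraicI[of "of_int_poly p"]) auto

lemma min_int_poly_dvd:
  assumes "algebraic x" "poly (of_int_poly q) x = 0"
  shows "min_int_poly x dvd q"
  by (rule is_min_int_poly_dvd[OF min_int_poly_is_min[OF assms(1)] assms(2)])

lemma alg_degree_le: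
  assumes "q \<noteq> 0" "poly (of_int_poly q) x = 0"
  shows "alg_degree x \<le> degree q"
  unfolding alg_degree_def
  by (rule dvd_imp_degree_le[OF min_int_poly_dvd[OF algebraicI_int_poly[OF assms] assms(2)] assms(1)])

lemma degree_pos_int_poly_root:
  assumes "q \<noteq> 0" "poly (of_int_poly q) (x :: complex) = 0"
  shows "degree q > 0"
  using assms by (cases "degree q = 0") (auto elim!: degree_eq_zeroE simp: hom_distribs)

lemma alg_degree_pos: "algebraic x \<Longrightarrow> alg_degree x > 0"
  unfolding alg_degree_def by (rule degree_pos_int_poly_root[OF min_int_poly(1,2)])

text \<open>The minimal polynomial of \<open>z\<close> divides that of \<open>x\<close>. The
  cofactor has smaller degree, so by minimality it cannot vanish at \<open>x\<close>; hence the
  divisor vanishes there and is itself minimal.\<close>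

lemma min_int_poly_conjugate:
  assumes x: "algebraic x" and z: "poly (of_int_poly (min_int_poly x)) z = 0"
  shows "min_int_poly z = min_int_poly x"
proof -
  let ?h = "min_int_poly x" and ?g = "min_int_poly z"
  have az: "algebraic z" using algebraicI_int_poly min_int_poly(1)[OF x] z by blast
  obtain c where c: "?h = ?g * c" using min_int_poly_dvd[OF az z] by (elim dvdE)
  have c0: "c \<noteq> 0" using min_int_poly(1)[OF x] c by auto
  have "poly (of_int_poly ?g) x * poly (of_int_poly c) x = poly (of_int_poly (?g * c)) x"
    by (simp add: hom_distribs)
  also have "\<dots> = 0" using min_int_poly(2)[OF x] c by simp
  finally consider "poly (of_int_poly ?g) x = 0" | "poly (of_int_poly c) x = 0" by auto
  hence "poly (of_int_poly ?g) x = 0"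
  proof cases
    case 2
    have "degree ?h = degree ?g + degree c"
      using c c0 min_int_poly(1)[OF az] by (simp add: degree_mult_eq)
    moreover have "degree ?h \<le> degree c"
      using alg_degree_le[OF c0 2] by (simp add: alg_degree_def)
    ultimately show ?thesis
      using alg_degree_pos[OF az] by (simp add: alg_degree_def)
  qed
  hence "is_min_int_poly x ?g"
    using min_int_poly[OF az] dvd_imp_degree_le[OF min_int_poly_dvd[OF az z] min_int_poly(1)[OF x]]
      min_int_poly_is_min[OF x] unfolding is_min_int_poly_def by (meson order_trans)
  thus ?thesis using is_min_int_poly_unique min_int_poly_is_min[OF x] by blast
qed

text \<open>A nonconstant \<open>P\<close> has a complex root, which is conjugate to
  \<open>x\<close>, so the minimal polynomial of \<open>x\<close> can be split off. The quotient is
  again primitive by Gauss's lemma, and the descent ends at a primitive constant, which is a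
  sign.\<close>

lemma primitive_eq_min_int_poly_power:
  assumes x: "algebraic x" and "content P = 1"
    and "\<And>z :: complex. poly (of_int_poly P) z = 0 \<Longrightarrow> poly (of_int_poly (min_int_poly x)) z = 0"
  shows "\<exists>k. \<exists>s\<in>{1, - 1}. P = smult s (min_int_poly x ^ k)"
  using assms(2,3)
proof (induction "degree P" arbitrary: P rule: less_induct)
  case less
  let ?h = "min_int_poly x"
  have P0: "P \<noteq> 0" using less.prems(1) by (metis content_0 zero_neq_one)
  show ?case
  proof (cases "degree P = 0")
    case True
    then obtain c where c: "P = [:c:]" by (rule degree_eq_zeroE)
    have "\<bar>c\<bar> = 1" using less.prems(1) unfolding c by simp
    hence "c \<in> {1, - 1}" by auto
    moreover have "P = smult c (?h ^ 0)" unfolding c by simp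
    ultimately show ?thesis by blast
  next
    case False
    hence "\<not> constant (poly (of_int_poly P :: complex poly))"
      by (simp add: constant_degree)
    from fundamental_theorem_of_algebra[OF this]
    obtain z :: complex where z: "poly (of_int_poly P) z = 0" by (rule exE)
    from less.prems(2)[OF z] have hz: "min_int_poly z = ?h" by (rule min_int_poly_conjugate[OF x])
    have "algebraic z" using algebraicI_int_poly[OF P0 z] .
    from min_int_poly_dvd[OF this z] obtain Q where Q: "P = ?h * Q" unfolding hz by (rule dvdE)
    have "degree ?h > 0" using alg_degree_pos[OF x] by (simp add: alg_degree_def)
    moreover have "degree P = degree ?h + degree Q" using P0 unfolding Q by (subst degree_mult_eq) auto
    ultimately have "degree Q < degree P" by simp
    moreover have "content Q = 1"
      using less.prems(1) min_int_poly(3)[OF x] unfolding Q by (simp add: content_mult)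
    moreover have "poly (of_int_poly ?h) w = 0" if "poly (of_int_poly Q) w = 0" for w :: complex
      using that by (intro less.prems(2)) (simp add: Q hom_distribs)
    ultimately have "\<exists>k. \<exists>s\<in>{1, - 1}. Q = smult s (?h ^ k)" by (rule less.hyps)
    then obtain k s where "s \<in> {1, - 1}" "Q = smult s (?h ^ k)" by blast
    hence "P = smult s (?h ^ Suc k)" "s \<in> {1, - 1}" unfolding Q by simp_all
    thus ?thesis by blast
  qed
qed

subsection \<open>Mahler measures of powers\<close>

lemma power_norm_int_factorization:
  assumes "n > 0"
  shows "\<exists>s \<in> {1, - 1}. of_int_poly (power_norm n p) =
    smult (s * of_int (lead_coeff p) ^ n) (\<Prod>a\<leftarrow>map (\<lambda>a. a ^ n) (complex_roots_int p). [:- a, 1:])"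
  using power_norm_prod_linear_factors[OF assms, of "of_int (lead_coeff p)" "complex_roots_int p"]
  unfolding complex_roots_int(1) power_norm_of_int list.map_comp o_def .

lemma mahler_measure_power_norm:
  assumes "n > 0"
  shows "mahler_measure (power_norm n p) = mahler_measure p ^ n"
proof -
  let ?as = "complex_roots_int p"
  obtain s :: complex where s: "s \<in> {1, - 1}" and eq: "of_int_poly (power_norm n p) =
      smult (s * of_int (lead_coeff p) ^ n) (\<Prod>a\<leftarrow>map (\<lambda>a. a ^ n) ?as. [:- a, 1:])"
    using power_norm_int_factorization[OF assms] by blast
  have "max 1 (c ^ n) = max 1 c ^ n" if "c \<ge> 0" for c :: real
  proof (cases "c \<le> 1")
    case True
    thus ?thesis using that by (simp add: power_le_one max_absorb1)
  next
    case False
    thus ?thesis by (simp add: one_le_power max_absorb2)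
  qed
  hence prod: "(\<Prod>a\<leftarrow>map (\<lambda>a. a ^ n) as. max 1 (cmod a)) = (\<Prod>a\<leftarrow>as. max 1 (cmod a)) ^ n" for as
    by (induction as) (simp_all add: norm_power power_mult_distrib)
  have "mahler_measure (power_norm n p) =
      cmod (s * of_int (lead_coeff p) ^ n) * (\<Prod>a\<leftarrow>map (\<lambda>a. a ^ n) ?as. max 1 (cmod a))"
    unfolding mahler_measure_def eq by (rule mahler_measure_poly_explicit)
  also have "\<dots> = (cmod (of_int (lead_coeff p)) * (\<Prod>a\<leftarrow>?as. max 1 (cmod a))) ^ n"
    unfolding prod using s by (auto simp: norm_mult norm_power power_mult_distrib)
  also have "\<dots> = mahler_measure p ^ n"
    unfolding mahler_measure_def complex_roots_int(1)[of p, symmetric]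
    by (simp only: mahler_measure_poly_explicit)
  finally show ?thesis .
qed

lemma degree_prod_linear_factors: "degree (\<Prod>a\<leftarrow>as. [:- a, 1 :: 'a :: idom:]) = length as"
  by (subst degree_linear_factors) simp

lemma lead_coeff_prod_linear_factors: "lead_coeff (\<Prod>a\<leftarrow>as. [:- a, 1 :: 'a :: idom:]) = 1"
  unfolding lead_coeff_of_prod by (induction as) auto

lemma lead_coeff_power_norm:
  assumes "n > 0"
  shows "degree (power_norm n p) = degree (p :: int poly)"
    "\<exists>s\<in>{1, - 1}. lead_coeff (power_norm n p) = s * lead_coeff p ^ n"
proof -
  let ?as = "map (\<lambda>a. a ^ n) (complex_roots_int p)"
  obtain s :: complex where s: "s \<in> {1, - 1}" and eq: "of_int_poly (power_norm n p) =
      smult (s * of_int (lead_coeff p) ^ n) (\<Prod>a\<leftarrow>?as. [:- a, 1:])"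
    using power_norm_int_factorization[OF assms] by blast
  have "degree (power_norm n p) = degree (of_int_poly (power_norm n p) :: complex poly)" by simp
  also have "\<dots> = degree p"
    unfolding eq degree_smult_eq degree_prod_linear_factors length_map complex_roots_int(2)
    using s assms by auto
  finally show "degree (power_norm n p) = degree p" .
  have "of_int (lead_coeff (power_norm n p)) = lead_coeff (of_int_poly (power_norm n p) :: complex poly)"
    by simp
  also have "\<dots> = s * of_int (lead_coeff p ^ n)"
    unfolding eq lead_coeff_smult lead_coeff_prod_linear_factors by simp
  finally have "complex_of_int (lead_coeff (power_norm n p)) = s * of_int (lead_coeff p ^ n)" .
  thus "\<exists>s\<in>{1, - 1}. lead_coeff (power_norm n p) = s * lead_coeff p ^ n"
    using s by (auto simp flip: of_int_minus of_int_power)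
qed

lemma poly_prod_linear_factors_eq_0_iff:
  "poly (\<Prod>a\<leftarrow>as. [:- a, 1 :: 'a :: idom:]) z = 0 \<longleftrightarrow> z \<in> set as"
  by (induction as) auto

lemma power_norm_root_iff:
  assumes "n > 0" "p \<noteq> 0"
  shows "poly (of_int_poly (power_norm n p)) (z :: complex) = 0 \<longleftrightarrow>
    (\<exists>a. poly (of_int_poly p) a = 0 \<and> z = a ^ n)"
proof -
  let ?as = "complex_roots_int p"
  obtain s :: complex where s: "s \<in> {1, - 1}" and eq: "of_int_poly (power_norm n p) =
      smult (s * of_int (lead_coeff p) ^ n) (\<Prod>a\<leftarrow>map (\<lambda>a. a ^ n) ?as. [:- a, 1:])"
    using power_norm_int_factorization[OF assms(1)] by blast
  have "poly (of_int_poly (power_norm n p)) z = 0 \<longleftrightarrow> z \<in> (\<lambda>a. a ^ n) ` set ?as"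
    unfolding eq poly_smult mult_eq_0_iff poly_prod_linear_factors_eq_0_iff using s assms(2) by auto
  moreover have "poly (of_int_poly p) a = 0 \<longleftrightarrow> a \<in> set ?as" for a
    unfolding complex_roots_int(1)[of p, symmetric] poly_smult mult_eq_0_iff
      poly_prod_linear_factors_eq_0_iff using assms(2) by auto
  ultimately show ?thesis by auto
qed

text \<open>Terms with coefficients divisible by \<open>d\<close> can be dropped from the top of \<open>p\<close> without changing the norm modulo \<open>d\<close>.\<close>

lemma prime_not_dvd_power_norm:
  fixes p :: "int poly"
  assumes "n > 0" "prime d" "\<not> [:d:] dvd p"
  shows "\<not> [:d:] dvd power_norm n p"
  using assms(3)
proof (induction "degree p" arbitrary: p rule: less_induct)
  case less
  show ?case
  proof (cases "d dvd lead_coeff p")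
    case False
    \<comment> \<open>The leading coefficient of the norm is up to sign the \<open>n\<close>-th
      power of that of \<open>p\<close>, so the prime \<open>d\<close> does not divide it.\<close>
    obtain s :: int where "s \<in> {1, - 1}" "lead_coeff (power_norm n p) = s * lead_coeff p ^ n"
      using lead_coeff_power_norm(2)[OF assms(1)] by blast
    hence "\<not> d dvd lead_coeff (power_norm n p)"
      using False prime_dvd_power[OF assms(2), of "lead_coeff p" n] by auto
    thus ?thesis using const_poly_dvd_iff by blast
  next
    case True
    then obtain c where c: "lead_coeff p = d * c" by (elim dvdE)
    define q where "q = p - monom (lead_coeff p) (degree p)"
    have p: "p = q + smult d (monom c (degree p))"
      by (simp add: q_def c smult_monom)
    have nd: "\<not> [:d:] dvd q"
    proof
      assume "[:d:] dvd q"
      hence "[:d:] dvd q + [:d:] * monom c (degree p)" by (rule dvd_add) (rule dvd_triv_left)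
      hence "[:d:] dvd q + smult d (monom c (degree p))" by simp
      thus False using less.prems by (simp only: p[symmetric])
    qed
    have "degree q < degree p"
    proof (rule degree_less_if_less_eqI)
      show "degree q \<le> degree p" unfolding q_def by (intro degree_diff_le degree_monom_le order_refl)
      show "coeff q (degree p) = 0" by (simp add: q_def)
      show "q \<noteq> 0" using nd by (metis dvd_0_right)
    qed
    hence "\<not> [:d:] dvd power_norm n q" using nd by (rule less.hyps)
    moreover have "[:d:] dvd power_norm n p - power_norm n q"
      by (subst p) (rule power_norm_cong)
    ultimately show ?thesis
      by (metis diff_add_cancel dvd_add_right_iff)
  qed
qed

lemma content_power_norm:
  fixes p :: "int poly"
  assumes "n > 0" "content p = 1"
  shows "content (power_norm n p) = 1"
proof (rule ccontr)
  let ?c = "content (power_norm n p)"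
  assume "?c \<noteq> 1"
  moreover have "power_norm n p \<noteq> 0"
    using lead_coeff_power_norm(2)[OF assms(1), of p] assms by auto
  moreover have "?c \<ge> 0" by (metis abs_ge_zero normalize_content normalize_int_def)
  ultimately have "\<not> is_unit ?c" "?c \<noteq> 0" by auto
  then obtain d where "prime d" "d dvd ?c" using prime_divisor_exists by blast
  moreover have "\<not> [:d:] dvd p"
    using not_prime_unit[of d] \<open>prime d\<close> unfolding const_poly_dvd_iff_dvd_content assms(2) by blast
  ultimately show False
    using prime_not_dvd_power_norm[OF assms(1)] const_poly_dvd_iff_dvd_content by blast
qed

lemma mahler_measure_mult: "mahler_measure (p * q) = mahler_measure p * mahler_measure q"
  unfolding mahler_measure_def by (simp only: measure_eq_prod hom_distribs)

lemma mahler_measure_const: "mahler_measure [:c:] = of_int \<bar>c\<bar>"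
proof -
  have "of_int_poly [:c:] = [:complex_of_int c:]" by (intro poly_eqI) (simp add: coeff_map_poly coeff_pCons split: nat.split)
  thus ?thesis unfolding mahler_measure_def by (simp only: mahler_measure_constant norm_of_int of_int_abs)
qed

lemma mahler_measure_smult: "mahler_measure (smult c p) = of_int \<bar>c\<bar> * mahler_measure p"
  using mahler_measure_mult[of "[:c:]" p] by (simp add: mahler_measure_const)

lemma mahler_measure_power: "mahler_measure (p ^ k) = mahler_measure p ^ k"
proof (induction k)
  case 0
  have "mahler_measure 1 = 1" using mahler_measure_const[of 1] by (simp only: one_pCons)
  thus ?case by simp
qed (simp add: mahler_measure_mult)

section \<open>Comparing algebraic numbers with a common power\<close>

lemma M_ge_1: "algebraic x \<Longrightarrow> M x \<ge> 1"
  unfolding M_def by (rule mahler_measure_poly_ge_1[OF min_int_poly(1)])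

lemma algebraic_power:
  fixes x :: complex
  assumes "algebraic x" "n > 0"
  shows "algebraic (x ^ n)"
proof -
  have "poly (of_int_poly (power_norm n (min_int_poly x))) (x ^ n) = 0"
    unfolding power_norm_root_iff[OF assms(2) min_int_poly(1)[OF assms(1)]]
    using min_int_poly(2)[OF assms(1)] by blast
  moreover have "power_norm n (min_int_poly x) \<noteq> 0"
    using content_power_norm[OF assms(2) min_int_poly(3)[OF assms(1)]] by auto
  ultimately show ?thesis by (intro algebraicI_int_poly)
qed

lemma poly_pcompose_monom_root:
  "poly (of_int_poly (pcompose p (monom 1 n))) (x :: complex) = poly (of_int_poly p) (x ^ n)"
  by (simp add: of_int_hom.map_poly_pcompose poly_pcompose poly_monom hom_distribs)

lemma algebraic_if_power_algebraic:
  fixes x :: complex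
  assumes "algebraic (x ^ n)" "n > 0"
  shows "algebraic x"
proof (rule algebraicI_int_poly)
  let ?h = "min_int_poly (x ^ n)"
  show "poly (of_int_poly (pcompose ?h (monom 1 n))) x = 0"
    unfolding poly_pcompose_monom_root by (rule min_int_poly(2)[OF assms(1)])
  show "pcompose ?h (monom 1 n) \<noteq> 0"
    using min_int_poly(1)[OF assms(1)] assms(2)
    by (subst pcompose_eq_0_iff) (auto simp: degree_monom_eq)
qed

text \<open>The minimal polynomial of \<open>x\<close> divides \<open>?h\<close> composed with
  \<open>y ^ n\<close>, so conjugates of \<open>x\<close> have \<open>n\<close>-th powers conjugate
  to \<open>x ^ n\<close>. The norm is therefore primitive with all its roots among those of
  \<open>?h\<close>, so it is a power of \<open>?h\<close> up to sign. Degrees and Mahler measures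
  are read off with the same exponent \<open>k\<close>.\<close>

lemma M_power:
  assumes x: "algebraic x" and n: "n > 0"
  shows "\<exists>k. alg_degree x = k * alg_degree (x ^ n) \<and> M x ^ n = M (x ^ n) ^ k"
proof -
  let ?f = "min_int_poly x" and ?h = "min_int_poly (x ^ n)"
  have xn: "algebraic (x ^ n)" using algebraic_power[OF x n] .
  have "?f dvd pcompose ?h (monom 1 n)"
    using min_int_poly(2)[OF xn] by (intro min_int_poly_dvd[OF x]) (simp add: poly_pcompose_monom_root)
  then obtain r where r: "pcompose ?h (monom 1 n) = ?f * r" by (elim dvdE)
  have root: "poly (of_int_poly ?h) (a ^ n) = 0" if "poly (of_int_poly ?f) a = 0" for a :: complex
    using that unfolding poly_pcompose_monom_root[symmetric] r by (simp add: hom_distribs)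
  have "poly (of_int_poly ?h) z = 0" if "poly (of_int_poly (power_norm n ?f)) z = 0" for z :: complex
    using that root unfolding power_norm_root_iff[OF n min_int_poly(1)[OF x]] by blast
  from primitive_eq_min_int_poly_power[OF xn content_power_norm[OF n min_int_poly(3)[OF x]] this]
  obtain k s where s: "s \<in> {1, - 1}" and eq: "power_norm n ?f = smult s (?h ^ k)" by blast
  have "degree ?f = degree (smult s (?h ^ k))"
    using lead_coeff_power_norm(1)[OF n, of ?f] eq by simp
  also have "\<dots> = k * degree ?h"
    using s min_int_poly(1)[OF xn] by (auto simp: degree_power_eq)
  finally have "alg_degree x = k * alg_degree (x ^ n)" by (simp add: alg_degree_def)
  moreover have "M x ^ n = M (x ^ n) ^ k"
    using mahler_measure_power_norm[OF n, of ?f] s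
    by (auto simp: eq M_def mahler_measure_smult mahler_measure_power)
  ultimately show ?thesis by blast
qed

text \<open>Both \<open>M x ^ n\<close> and \<open>M y ^ n\<close> are powers of the same number
  \<open>M (x ^ n)\<close>, which is at least 1, and the exponents are ordered like the
  degrees.\<close>

lemma M_le_if_powers_eq:
  assumes x: "algebraic x" and n: "n > 0" and eq: "x ^ n = y ^ n"
    and deg: "alg_degree x \<le> alg_degree y"
  shows "M x \<le> M y"
proof -
  have y: "algebraic y"
    using algebraic_if_power_algebraic[OF _ n] algebraic_power[OF x n] eq by simp
  obtain k where k: "alg_degree x = k * alg_degree (x ^ n)" "M x ^ n = M (x ^ n) ^ k"
    using M_power[OF x n] by blast
  obtain l where l: "alg_degree y = l * alg_degree (x ^ n)" "M y ^ n = M (x ^ n) ^ l"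
    using M_power[OF y n] eq by auto
  have "k \<le> l"
    using deg alg_degree_pos[OF algebraic_power[OF x n]] by (simp add: k(1) l(1))
  hence "M x ^ n \<le> M y ^ n"
    unfolding k(2) l(2) using M_ge_1[OF algebraic_power[OF x n]] by (intro power_increasing)
  moreover have "0 \<le> M x" "0 \<le> M y" using M_ge_1[OF x] M_ge_1[OF y] by simp_all
  ultimately show ?thesis using n power_mono_iff by blast
qed

section \<open>The infimum over roots of unity\<close>

lemma algebraic_root_of_unity_mult:
  assumes "algebraic x" "root_of_unity z"
  shows "algebraic (z * x)"
proof -
  obtain n where "n > 0" "z ^ n = 1" using assms(2) by (auto simp: root_of_unity_def)
  thus ?thesis
    using algebraic_if_power_algebraic[of "z * x" n] algebraic_power[OF assms(1), of n]
    by (simp add: power_mult_distrib)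
qed

lemma Mbar_eqI:
  assumes x: "algebraic x" and z: "root_of_unity z"
    and min: "\<And>w. root_of_unity w \<Longrightarrow> alg_degree (z * x) \<le> alg_degree (w * x)"
  shows "Mbar x = M (z * x)"
  unfolding Mbar_def
proof (rule cInf_eq_minimum)
  show "M (z * x) \<in> (\<lambda>z. M (z * x)) ` {z. root_of_unity z}" using z by simp
next
  fix m assume "m \<in> (\<lambda>z. M (z * x)) ` {z. root_of_unity z}"
  then obtain w where w: "root_of_unity w" "m = M (w * x)" by auto
  from z obtain i where i: "i > 0" "z ^ i = 1" by (auto simp: root_of_unity_def)
  from w obtain j where j: "j > 0" "w ^ j = 1" by (auto simp: root_of_unity_def)
  \<comment> \<open>A common exponent for both roots of unity makes \<open>z * x\<close> and
    \<open>w * x\<close> share a power, so that their Mahler measures are ordered like their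
    degrees.\<close>
  have "z ^ (i * j) = 1" "w ^ (i * j) = 1"
    using i j by (simp_all add: power_mult) (metis mult.commute power_mult power_one)
  hence "(z * x) ^ (i * j) = (w * x) ^ (i * j)" by (simp add: power_mult_distrib)
  thus "M (z * x) \<le> m"
    unfolding w(2) using i j min[OF w(1)] algebraic_root_of_unity_mult[OF x z]
    by (intro M_le_if_powers_eq[of _ "i * j"]) auto
qed

subsection \<open>Quadratic roots of unity\<close>

lemma complex_of_rat_eq_of_real: "(of_rat r :: complex) = of_real (of_rat r)"
  by (cases r) (simp add: of_rat_rat)

lemma Re_of_rat [simp]: "Re (of_rat r) = of_rat r"
  by (simp add: complex_of_rat_eq_of_real)

lemma Im_of_rat [simp]: "Im (of_rat r) = 0"
  by (simp add: complex_of_rat_eq_of_real)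

lemma of_rat_obtain_int_quotient:
  obtains a b :: int where "b > 0" "(of_rat r :: complex) = of_int a / of_int b"
  by (rule Rats_cases'[of "of_rat r :: complex"]) auto

lemma algebraic_of_rat: "algebraic (of_rat r :: complex)"
  and alg_degree_of_rat_le: "alg_degree (of_rat r) \<le> 1"
proof -
  obtain a b :: int where ab: "b > 0" "(of_rat r :: complex) = of_int a / of_int b"
    by (rule of_rat_obtain_int_quotient)
  let ?p = "[:- a, b:]"
  have p: "?p \<noteq> 0" using ab(1) by simp
  have root: "poly (of_int_poly ?p) (of_rat r :: complex) = 0"
    using ab by (simp add: hom_distribs)
  show "algebraic (of_rat r :: complex)" by (rule algebraicI_int_poly[OF p root])
  have "degree ?p \<le> 1" by simp
  with alg_degree_le[OF p root] show "alg_degree (of_rat r) \<le> 1" by (rule order_trans)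
qed

lemma poly_degree_le_2: "degree p \<le> 2 \<Longrightarrow> p = [:coeff p 0, coeff p 1, coeff p 2:]"
proof (rule poly_eqI)
  fix n assume "degree p \<le> 2"
  hence "coeff p n = 0" if "n > 2" using that by (intro coeff_eq_0) simp
  thus "coeff p n = coeff [:coeff p 0, coeff p 1, coeff p 2:] n"
    by (cases n; cases "n - 1"; cases "n - 2")
      (auto simp: coeff_pCons numeral_2_eq_2 split: nat.splits)
qed

lemma min_int_poly_degree_le_2_root:
  assumes "algebraic x" "alg_degree x \<le> 2"
  defines "c \<equiv> coeff (min_int_poly x)"
  shows "of_int (c 0) + of_int (c 1) * x + of_int (c 2) * x ^ 2 = 0"
proof -
  have "min_int_poly x = [:c 0, c 1, c 2:]"
    using assms(2) unfolding alg_degree_def c_def by (rule poly_degree_le_2)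
  hence "poly (of_int_poly [:c 0, c 1, c 2:]) x = 0" using min_int_poly(2)[OF assms(1)] by simp
  thus ?thesis by (simp add: hom_distribs algebra_simps power2_eq_square)
qed

lemma alg_degree_le_1_imp_rational:
  assumes "algebraic x" "alg_degree x \<le> 1"
  shows "\<exists>r. x = of_rat r"
proof -
  let ?c = "coeff (min_int_poly x)"
  have deg: "degree (min_int_poly x) = 1"
    using alg_degree_pos[OF assms(1)] assms(2) by (simp add: alg_degree_def)
  hence c1: "?c 1 \<noteq> 0" using min_int_poly(1)[OF assms(1)] by (metis leading_coeff_neq_0)
  have c2: "?c 2 = 0" using deg by (intro coeff_eq_0) simp
  have "of_int (?c 0) + of_int (?c 1) * x = 0"
    using min_int_poly_degree_le_2_root[OF assms(1)] assms(2) c2 by simp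
  hence "of_int (?c 1) * x = - of_int (?c 0)" by (simp add: add_eq_0_iff)
  hence "x = - of_int (?c 0) / of_int (?c 1)" using c1 by (simp add: field_simps)
  also have "\<dots> = of_rat (- of_int (?c 0) / of_int (?c 1))"
    by (simp add: of_rat_divide of_rat_minus)
  finally show ?thesis by blast
qed

lemma root_of_unity_algebraic: "root_of_unity z \<Longrightarrow> algebraic z"
  using algebraic_root_of_unity_mult[OF algebraic_of_rat[of 1], of z] by simp

text \<open>The minimal polynomial divides the monic polynomial \<open>monom 1 n - 1\<close> over
  the integers, so its leading coefficient is a positive unit.\<close>

lemma root_of_unity_lead_coeff:
  assumes "root_of_unity z"
  shows "lead_coeff (min_int_poly z) = 1"
proof -
  obtain n where n: "n > 0" "z ^ n = 1" using assms by (auto simp: root_of_unity_def)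
  define q :: "int poly" where "q = monom 1 n - 1"
  have "poly (of_int_poly q) z = 0" using n by (simp add: q_def hom_distribs poly_monom)
  from min_int_poly_dvd[OF root_of_unity_algebraic[OF assms] this]
  obtain k where k: "q = min_int_poly z * k" by (rule dvdE)
  have "degree q = n" "coeff q n = 1"
  proof -
    have "degree (- 1 + monom 1 n :: int poly) = degree (monom 1 n :: int poly)"
      using n by (intro degree_add_eq_right) (simp add: degree_monom_eq)
    thus "degree q = n" by (simp add: q_def degree_monom_eq)
    show "coeff q n = 1" using n by (simp add: q_def)
  qed
  hence "lead_coeff (min_int_poly z) * lead_coeff k = 1"
    unfolding lead_coeff_mult[symmetric] k[symmetric] by simp
  thus ?thesis
    using min_int_poly(4)[OF root_of_unity_algebraic[OF assms]] by (simp add: zmult_eq_1_iff)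
qed

lemma root_of_unity_norm: "root_of_unity z \<Longrightarrow> cmod z = 1"
  unfolding root_of_unity_def by (auto dest: power_eq_1_iff)

text \<open>The imaginary part of the quadratic equation gives \<open>2 * Re z\<close> as minus the
  linear coefficient once the equation is known to be monic. Since \<open>z\<close> lies on the unit
  circle off the real axis, this integer has absolute value below 2.\<close>

lemma Re_quadratic_root_of_unity:
  assumes z: "root_of_unity z" and deg: "alg_degree z \<le> 2" and im: "Im z \<noteq> 0"
  shows "Re z \<in> {0, 1/2, -1/2}"
proof -
  let ?c = "coeff (min_int_poly z)"
  note alg = root_of_unity_algebraic[OF z]
  have eq: "of_int (?c 0) + of_int (?c 1) * z + of_int (?c 2) * z ^ 2 = 0"
    by (rule min_int_poly_degree_le_2_root[OF alg deg])
  hence "Im (of_int (?c 0) + of_int (?c 1) * z + of_int (?c 2) * z ^ 2) = 0" by simp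
  hence "Im z * (of_int (?c 1) + 2 * of_int (?c 2) * Re z) = 0"
    by (simp add: power2_eq_square algebra_simps)
  hence re: "of_int (?c 1) + 2 * of_int (?c 2) * Re z = 0" using im by simp
  have "?c 2 = 1"
  proof (cases "?c 2 = 0")
    \<comment> \<open>Without a quadratic term the relation \<open>re\<close> kills the linear
      coefficient too, and then the whole polynomial.\<close>
    case True
    with re have "?c 1 = 0" by simp
    with True eq have "?c 0 = 0" by simp
    with True \<open>?c 1 = 0\<close> have "min_int_poly z = 0"
      using poly_degree_le_2[of "min_int_poly z"] deg unfolding alg_degree_def by simp
    thus ?thesis using min_int_poly(1)[OF alg] by simp
  next
    case False
    hence "degree (min_int_poly z) = 2" using deg le_degree[OF False] by (simp add: alg_degree_def)
    thus ?thesis using root_of_unity_lead_coeff[OF z] by simp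
  qed
  with re have re: "Re z = - of_int (?c 1) / 2" by simp
  have "Re z ^ 2 + Im z ^ 2 = 1" using root_of_unity_norm[OF z] by (simp add: cmod_def)
  hence "Re z ^ 2 < 1" using im by (smt (verit) zero_less_power2)
  hence "\<bar>Re z\<bar> < 1" by (simp add: abs_square_less_1)
  hence "\<bar>?c 1\<bar> < 2" unfolding re by simp
  hence "?c 1 \<in> {-1, 0, 1}" by auto
  thus ?thesis unfolding re by auto
qed

lemma degree_2_rational_multiple_of_root_of_unity:
  assumes x: "algebraic x" "x \<noteq> 0" "alg_degree x = 2"
    and w: "root_of_unity w" "alg_degree (w * x) \<le> 1"
  shows "\<exists>r. r \<noteq> 0 \<and> (x = of_rat r * \<i> \<or> x = of_rat r * (1 + \<i> * complex_of_real (sqrt 3))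
    \<or> x = of_rat r * (1 - \<i> * complex_of_real (sqrt 3)))"
proof -
  obtain r where r: "w * x = of_rat r"
    using alg_degree_le_1_imp_rational[OF algebraic_root_of_unity_mult[OF x(1) w(1)] w(2)] by blast
  define z where "z = inverse w"
  have w0: "w \<noteq> 0" using root_of_unity_norm[OF w(1)] by auto
  have xz: "x = of_rat r * z" using w0 r by (simp add: z_def field_simps)
  have r0: "r \<noteq> 0" using x(2) xz by auto
  have z: "root_of_unity z"
    using w(1) unfolding root_of_unity_def z_def by (metis inverse_1 power_inverse)
  obtain a b :: int where ab: "b > 0" "(of_rat r :: complex) = of_int a / of_int b"
    by (rule of_rat_obtain_int_quotient)
  have a0: "a \<noteq> 0" using ab r0 by auto
  \<comment> \<open>Substituting \<open>x = (a / b) * z\<close> in the integer equation of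
    \<open>x\<close> and multiplying by \<open>b ^ 2\<close> gives an integer equation for
    \<open>z\<close> of degree two.\<close>
  have "alg_degree z \<le> 2"
  proof -
    let ?c = "coeff (min_int_poly x)"
    have c2: "?c 2 \<noteq> 0"
      using x(3) min_int_poly(1)[OF x(1)] unfolding alg_degree_def by (metis leading_coeff_neq_0)
    have "of_int (?c 0) + of_int (?c 1) * x + of_int (?c 2) * x ^ 2 = 0"
      using x(3) by (intro min_int_poly_degree_le_2_root[OF x(1)]) simp
    moreover have bx: "of_int b * x = of_int a * z" using ab unfolding xz ab(2) by simp
    moreover have "of_int (?c 0 * b ^ 2) + z * (of_int (?c 1 * a * b) + z * of_int (?c 2 * a ^ 2)) =
        of_int (?c 0) * of_int b ^ 2 + of_int (?c 1) * of_int b * (of_int a * z)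
        + of_int (?c 2) * (of_int a * z) ^ 2"
      by (simp add: algebra_simps power2_eq_square)
    moreover have "\<dots> = of_int b ^ 2 * (of_int (?c 0) + of_int (?c 1) * x + of_int (?c 2) * x ^ 2)"
      unfolding bx[symmetric] by (simp add: algebra_simps power2_eq_square)
    ultimately have "of_int (?c 0 * b ^ 2) +
        z * (of_int (?c 1 * a * b) + z * of_int (?c 2 * a ^ 2)) = 0"
      by (simp only: mult_zero_right)
    hence "poly (of_int_poly [:?c 0 * b ^ 2, ?c 1 * a * b, ?c 2 * a ^ 2:]) z = 0"
      by (simp add: hom_distribs)
    moreover have "[:?c 0 * b ^ 2, ?c 1 * a * b, ?c 2 * a ^ 2:] \<noteq> 0" using c2 a0 by simp
    ultimately have "alg_degree z \<le> degree [:?c 0 * b ^ 2, ?c 1 * a * b, ?c 2 * a ^ 2:]"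
      by (intro alg_degree_le)
    also have "\<dots> \<le> 2" by simp
    finally show ?thesis .
  qed
  have norm: "Re z ^ 2 + Im z ^ 2 = 1" using root_of_unity_norm[OF z] by (simp add: cmod_def)
  have im: "Im z \<noteq> 0"
  proof
    assume im: "Im z = 0"
    \<comment> \<open>A real root of unity is a sign, which would make \<open>x\<close> rational and
      contradict degree two.\<close>
    hence "Re z = 1 \<or> Re z = - 1" using norm by (simp add: power2_eq_1_iff)
    hence "z = of_rat 1 \<or> z = of_rat (- 1)" using im by (auto simp: complex_eq_iff)
    hence "\<exists>s. x = of_rat s" unfolding xz by (metis of_rat_mult)
    thus False using alg_degree_of_rat_le x(3) by (metis one_le_numeral numeral_le_one_iff semiring_norm(69))
  qed
  have "Re z \<in> {0, 1/2, -1/2}" by (rule Re_quadratic_root_of_unity[OF z \<open>alg_degree z \<le> 2\<close> im])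
  moreover have "(of_rat (1/2) :: real) = 1/2" "(of_rat (-1/2) :: real) = -1/2"
    by (simp_all add: of_rat_divide of_rat_minus)
  ultimately consider "Re z = 0" | s :: rat where "s \<in> {1/2, -1/2}" "Re z = of_rat s"
    by (metis insertCI insertE singletonD)
  thus ?thesis
  proof cases
    case 1
    hence "Im z = 1 \<or> Im z = - 1" using norm by (simp add: power2_eq_1_iff)
    hence "x = of_rat r * \<i> \<or> x = of_rat (- r) * \<i>"
      using 1 unfolding xz by (auto simp: complex_eq_iff of_rat_minus)
    thus ?thesis using r0 by (metis neg_equal_0_iff_equal)
  next
    case 2
    have "s = 1/2 \<or> s = -1/2" using 2(1) by (metis insertE singletonD)
    hence s2: "s ^ 2 = 1 / 4" by (elim disjE; hypsubst) (simp_all add: power2_eq_square)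
    hence "(of_rat s :: real) ^ 2 = 1 / 4"
      by (metis of_rat_power of_rat_divide of_rat_1 of_rat_numeral_eq)
    hence "Im z ^ 2 = (of_rat s * sqrt 3) ^ 2" using norm 2(2) by (simp add: power_mult_distrib)
    hence "Im z = of_rat s * sqrt 3 \<or> Im z = - (of_rat s * sqrt 3)" by (simp add: power2_eq_iff)
    \<comment> \<open>Here \<open>z\<close> is \<open>s\<close> times
      \<open>1 + \<i> * sqrt 3\<close> or its conjugate, so the rational \<open>s\<close> is
      absorbed into the factor.\<close>
    hence "x = of_rat (r * s) * (1 + \<i> * complex_of_real (sqrt 3)) \<or>
        x = of_rat (r * s) * (1 - \<i> * complex_of_real (sqrt 3))"
      using 2(2) unfolding xz by (auto simp: complex_eq_iff of_rat_mult)
    moreover have "r * s \<noteq> 0" using r0 2(1) by auto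
    ultimately show ?thesis by blast
  qed
qed

lemma root_of_unity_1: "root_of_unity 1"
  unfolding root_of_unity_def by auto

text \<open>If no root of unity lowers the degree, the infimum is attained at 1. Otherwise the
  degree drops from two to one, which forces one of the listed shapes.\<close>

lemma Mbar_eq_M_or_rational_multiple:
  assumes x: "algebraic x" "x \<noteq> 0" "alg_degree x \<le> 2"
  shows "Mbar x = M x \<or> (\<exists>r. r \<noteq> 0 \<and> (x = of_rat r * \<i>
    \<or> x = of_rat r * (1 + \<i> * complex_of_real (sqrt 3))
    \<or> x = of_rat r * (1 - \<i> * complex_of_real (sqrt 3))))"
proof (cases "\<forall>w. root_of_unity w \<longrightarrow> alg_degree x \<le> alg_degree (w * x)")
  case True
  hence "Mbar x = M (1 * x)" by (intro Mbar_eqI x(1) root_of_unity_1) simp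
  thus ?thesis by simp
next
  case False
  then obtain w where w: "root_of_unity w" "alg_degree (w * x) < alg_degree x" by auto
  moreover have "alg_degree (w * x) > 0"
    by (intro alg_degree_pos algebraic_root_of_unity_mult x(1) w(1))
  ultimately have "alg_degree x = 2" "alg_degree (w * x) \<le> 1" using x(3) by simp_all
  from degree_2_rational_multiple_of_root_of_unity[OF x(1,2) this(1) w(1) this(2)]
  show ?thesis by (rule disjI2)
qed

text \<open>A rational number has the least degree possible for an algebraic number, so the infimum
  is attained at \<open>w\<close>.\<close>

lemma Mbar_eq_M_of_rat:
  assumes "algebraic x" "root_of_unity w" "w * x = of_rat r"
  shows "Mbar x = M (of_rat r)"
proof -
  have "alg_degree (w * x) \<le> alg_degree (v * x)" if "root_of_unity v" for v
    using alg_degree_pos[OF algebraic_root_of_unity_mult[OF assms(1) that]] alg_degree_of_rat_le[of r]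
    unfolding assms(3) by linarith
  from Mbar_eqI[OF assms(1,2) this] show ?thesis unfolding assms(3) .
qed

section \<open>Generated subfields and the irrationality of the square root of 3\<close>

lemma of_rat_in_subfield:
  assumes F: "is_subfield_C F"
  shows "of_rat r \<in> F"
proof -
  have nat: "of_nat n \<in> F" for n
    using F by (induction n) (auto simp: is_subfield_C_def)
  have int: "of_int k \<in> F" for k
    using F nat by (cases k) (auto simp: is_subfield_C_def simp del: of_nat_Suc)
  obtain a b :: int where ab: "b > 0" "(of_rat r :: complex) = of_int a / of_int b"
    by (rule of_rat_obtain_int_quotient)
  have "inverse (of_int b) \<in> F" using F int ab(1) by (auto simp: is_subfield_C_def)
  thus ?thesis using F int unfolding ab(2) divide_inverse by (auto simp: is_subfield_C_def)
qed

lemma is_subfield_Qadj: "is_subfield_C (Qadj x)"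
  unfolding Qadj_def by (auto simp: is_subfield_C_def)

lemma Qadj_self: "x \<in> Qadj x"
  unfolding Qadj_def by blast

lemma Qadj_subset: "x \<in> Qadj y \<Longrightarrow> Qadj x \<subseteq> Qadj y"
  unfolding Qadj_def[of x] by (rule Inter_lower) (simp add: is_subfield_Qadj)

lemma Qadj_affine_subset: "Qadj (of_rat a + of_rat b * y) \<subseteq> Qadj y"
  using is_subfield_Qadj[of y] of_rat_in_subfield[OF is_subfield_Qadj[of y]] Qadj_self[of y]
  by (intro Qadj_subset) (simp add: is_subfield_C_def)

lemma Qadj_affine:
  assumes "b \<noteq> 0"
  shows "Qadj (of_rat a + of_rat b * y) = Qadj y"
proof (rule antisym[OF Qadj_affine_subset])
  have b: "(of_rat b :: complex) \<noteq> 0" using assms by simp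
  \<comment> \<open>Inverting the affine map turns the reverse inclusion into another instance of
    \<open>Qadj_affine_subset\<close>.\<close>
  have "of_rat (- a / b) + of_rat (1 / b) * (of_rat a + of_rat b * y) =
      - of_rat a / of_rat b + (of_rat a + of_rat b * y) / of_rat b"
    by (simp add: of_rat_divide of_rat_minus)
  also have "\<dots> = y" using b by (simp add: add_divide_distrib)
  finally have y: "of_rat (- a / b) + of_rat (1 / b) * (of_rat a + of_rat b * y) = y" .
  show "Qadj y \<subseteq> Qadj (of_rat a + of_rat b * y)"
    using Qadj_affine_subset[of "- a / b" "1 / b" "of_rat a + of_rat b * y"] unfolding y .
qed

text \<open>A rational algebraic integer is an integer, and none lies strictly between 1 and
  2.\<close>

lemma sqrt_3_irrational: "sqrt 3 \<notin> \<rat>"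
proof
  assume "sqrt 3 \<in> \<rat>"
  moreover have "algebraic_int (sqrt 3)" by (intro algebraic_int_sqrt) simp
  ultimately have "sqrt 3 \<in> \<int>" by (intro rational_algebraic_int_is_int)
  then obtain k :: int where k: "sqrt 3 = of_int k" by (auto elim: Ints_cases)
  have "1 < sqrt 3" "sqrt 3 < 2" by (simp_all add: real_less_lsqrt)
  thus False unfolding k by simp
qed

lemma of_rat_mult_sqrt_3_eq_of_rat:
  assumes "of_rat b * sqrt 3 = of_rat r"
  shows "b = 0" "r = 0"
proof -
  show b: "b = 0"
  proof (rule ccontr)
    assume "b \<noteq> 0"
    hence "sqrt 3 = of_rat (r / b)" using assms by (simp add: of_rat_divide field_simps)
    thus False using sqrt_3_irrational by (metis Rats_of_rat)
  qed
  show "r = 0" using assms unfolding b by simp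
qed

theorem mainTheorem4:
  fixes \<gamma> :: complex
  assumes "algebraic \<gamma>" and "\<gamma> \<noteq> 0" and "alg_degree \<gamma> \<le> 2"
  shows "(Qadj \<gamma> \<noteq> Qadj \<i> \<and> Qadj \<gamma> \<noteq> Qadj (\<i> * complex_of_real (sqrt 3))
            \<longrightarrow> Mbar \<gamma> = M \<gamma>)
       \<and> (\<forall>a b :: rat. \<gamma> = of_rat a + of_rat b * \<i> \<longrightarrow>
            Mbar \<gamma> = (if a = 0 then M (of_rat b) else M \<gamma>))
       \<and> (\<forall>a b :: rat. \<gamma> = of_rat a + of_rat b * (\<i> * complex_of_real (sqrt 3)) \<longrightarrow>
            Mbar \<gamma> = (if a = b \<or> a = - b then M (of_rat (2 * a)) else M \<gamma>))"
proof (intro conjI impI allI)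
  let ?s = "\<i> * complex_of_real (sqrt 3)"
  note dichotomy = Mbar_eq_M_or_rational_multiple[OF assms]
  {
    assume nQ: "Qadj \<gamma> \<noteq> Qadj \<i> \<and> Qadj \<gamma> \<noteq> Qadj ?s"
    have "\<gamma> \<noteq> of_rat r * \<i>" "\<gamma> \<noteq> of_rat r * (1 + ?s)" "\<gamma> \<noteq> of_rat r * (1 - ?s)" if "r \<noteq> 0" for r
    proof -
      \<comment> \<open>Each exceptional shape is an affine image of \<open>\<i>\<close> or
        \<open>?s\<close> with nonzero slope, so it generates one of the two excluded
        fields.\<close>
      have "of_rat r * \<i> = of_rat 0 + of_rat r * \<i>"
        "of_rat r * (1 + ?s) = of_rat r + of_rat r * ?s"
        "of_rat r * (1 - ?s) = of_rat r + of_rat (- r) * ?s"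
        by (simp_all add: algebra_simps of_rat_minus)
      thus "\<gamma> \<noteq> of_rat r * \<i>" "\<gamma> \<noteq> of_rat r * (1 + ?s)" "\<gamma> \<noteq> of_rat r * (1 - ?s)"
        using nQ that by (metis Qadj_affine neg_equal_0_iff_equal)+
    qed
    thus "Mbar \<gamma> = M \<gamma>" using dichotomy by blast
  next
    fix a b :: rat
    assume g: "\<gamma> = of_rat a + of_rat b * \<i>"
    show "Mbar \<gamma> = (if a = 0 then M (of_rat b) else M \<gamma>)"
    proof (cases "a = 0")
      case True
      \<comment> \<open>Multiplication by \<open>- \<i>\<close> rotates the imaginary axis onto the
        real one.\<close>
      have "root_of_unity (- \<i>)" unfolding root_of_unity_def by (intro exI[of _ 4]) simp
      moreover have "- \<i> * \<gamma> = of_rat b" using True g by (simp add: complex_eq_iff)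
      ultimately show ?thesis using True Mbar_eq_M_of_rat[OF assms(1)] by simp
    next
      case False
      have "\<gamma> \<noteq> of_rat r * \<i>" for r using False g by (auto simp: complex_eq_iff)
      \<comment> \<open>Imaginary parts would give \<open>b\<close> or \<open>- b\<close> equal to
        \<open>r * sqrt 3\<close>, impossible for nonzero \<open>r\<close> by irrationality.\<close>
      moreover have "\<gamma> \<noteq> of_rat r * (1 + ?s)" "\<gamma> \<noteq> of_rat r * (1 - ?s)" if "r \<noteq> 0" for r
        using that g of_rat_mult_sqrt_3_eq_of_rat(1)[of r b] of_rat_mult_sqrt_3_eq_of_rat(1)[of r "- b"]
        by (auto simp: complex_eq_iff of_rat_minus)
      ultimately show ?thesis using False dichotomy by auto
    qed
  next
    fix a b :: rat
    assume g: "\<gamma> = of_rat a + of_rat b * ?s"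
    show "Mbar \<gamma> = (if a = b \<or> a = - b then M (of_rat (2 * a)) else M \<gamma>)"
    proof (cases "a = b \<or> a = - b")
      case True
      \<comment> \<open>The sign \<open>e\<close> treats \<open>a = b\<close> and
        \<open>a = - b\<close> together, as \<open>\<gamma> = a * (1 + e * ?s)\<close>. The factor
        \<open>w\<close> is half the conjugate of \<open>1 + e * ?s\<close>, a number of norm 4, so
        the product is \<open>2 * a\<close>; moreover \<open>w ^ 3 = - 1\<close>.\<close>
      define e :: complex where "e = (if a = b then 1 else - 1)"
      define w where "w = (1 - e * ?s) / 2"
      have e: "e ^ 2 = 1" by (simp add: e_def)
      have s: "?s ^ 2 = - 3" by (simp add: power_mult_distrib flip: of_real_power)
      have es: "(e * ?s) ^ 2 = - 3" using e s by (simp only: power_mult_distrib) simp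
      have "w ^ 2 = - (1 + e * ?s) / 2"
        using es unfolding w_def power2_eq_square by (simp add: field_simps)
      hence "w ^ 3 = - (1 - (e * ?s) ^ 2) / 4"
        unfolding power3_eq_cube power2_eq_square by (simp add: w_def field_simps)
      hence "w ^ 3 = - 1" unfolding es by simp
      hence "(w ^ 3) ^ 2 = 1" by simp
      hence "w ^ 6 = 1" by (simp flip: power_mult)
      hence "root_of_unity w" unfolding root_of_unity_def by (intro exI[of _ 6]) simp
      moreover have "w * \<gamma> = of_rat (2 * a)"
      proof -
        have "\<gamma> = of_rat a * (1 + e * ?s)" using True g by (auto simp: e_def algebra_simps of_rat_minus)
        hence "w * \<gamma> = of_rat a * (1 - (e * ?s) ^ 2) / 2"
          by (simp add: w_def field_simps power2_eq_square)
        thus ?thesis unfolding es by (simp add: of_rat_mult)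
      qed
      ultimately show ?thesis using True Mbar_eq_M_of_rat[OF assms(1)] by simp
    next
      case False
      \<comment> \<open>Here irrationality enters through \<open>b * sqrt 3 = r\<close>; the other
        two shapes are excluded by comparing coefficients, which would give \<open>a = b\<close> or
        \<open>a = - b\<close>.\<close>
      have "\<gamma> \<noteq> of_rat r * \<i>" if "r \<noteq> 0" for r
        using that g of_rat_mult_sqrt_3_eq_of_rat(2)[of b r] by (auto simp: complex_eq_iff)
      moreover have "\<gamma> \<noteq> of_rat r * (1 + ?s)" for r
        using False g by (auto simp: complex_eq_iff)
      moreover have "\<gamma> \<noteq> of_rat r * (1 - ?s)" for r
      proof
        assume "\<gamma> = of_rat r * (1 - ?s)"
        hence "a = r" "of_rat b * sqrt 3 = of_rat (- r) * sqrt 3"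
          using g by (auto simp: complex_eq_iff of_rat_minus)
        hence "b = - a" unfolding mult_cancel_right by simp
        thus False using False by simp
      qed
      ultimately show ?thesis using False dichotomy by auto
    qed
  }
qed

end
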